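(* Let $p:[0,1]\to(1,+\infty)$ be continuous. Then $\mathscr C([0,1])\subset L^{p(\cdot)}([0,1])$ and $\|u\|_{L^{p(\cdot)}}\le\|u\|_\infty$ for all $u\in\mathscr C([0,1])$.
   Context: $\mathscr C([0,1])$ is the space of continuous real functions on $[0,1]$ with supremum norm $\|\cdot\|_\infty$. $L^{p(\cdot)}([0,1])$ is the variable exponent Lebesgue space with Luxemburg norm $\|u\|_{L^{p(\cdot)}}:=\inf\{\delta>0:\int_0^1|u(x)/\delta|^{p(x)}\,dx\le1\}$. By continuity, $1<p^-:=\min p\le p(t)\le p^+:=\max p<+\infty$. *)

theory Defs
  imports "HOL-Analysis.Analysis"
begin

text \<open>
  Functions on the unit interval are represented by total functions on the reals of which only the
  restriction to \<open>{0..1}\<close> matters. Elements of the variable exponent space are representatives; they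
  are not identified almost everywhere.
\<close>

definition C01 :: "(real \<Rightarrow> real) set" where
  "C01 = {u. continuous_on {0..1} u}"

definition sup_norm01 :: "(real \<Rightarrow> real) \<Rightarrow> real" where
  "sup_norm01 u = (SUP x\<in>{0..1}. \<bar>u x\<bar>)"

text \<open>The nonnegative integral keeps the value \<open>\<infinity>\<close> for functions that are not integrable.\<close>

definition modular :: "(real \<Rightarrow> real) \<Rightarrow> (real \<Rightarrow> real) \<Rightarrow> ennreal" where
  "modular p u = (\<integral>\<^sup>+x. ennreal (\<bar>u x\<bar> powr p x) \<partial>lebesgue_on {0..1})"

definition Lp_var :: "(real \<Rightarrow> real) \<Rightarrow> (real \<Rightarrow> real) set" where
  "Lp_var p = {u \<in> borel_measurable (lebesgue_on {0..1}).
     \<exists>\<delta>>0. modular p (\<lambda>x. u x / \<delta>) < \<infinity>}"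

text \<open>
  For \<open>u \<in> Lp_var p\<close> with a measurable positive exponent the set below is nonempty, by dominated
  convergence as \<open>\<delta> \<rightarrow> \<infinity>\<close>, so the infimum is the intended one. For other \<open>u\<close> it has no meaning.
\<close>

definition luxemburg_norm :: "(real \<Rightarrow> real) \<Rightarrow> (real \<Rightarrow> real) \<Rightarrow> real" where
  "luxemburg_norm p u = Inf {\<delta>. 0 < \<delta> \<and> modular p (\<lambda>x. u x / \<delta>) \<le> 1}"

end

theory Submission
  imports Defs
begin

text \<open>If \<open>\<delta>\<close> exceeds the supremum norm of \<open>u\<close>, then
  \<open>\<bar>u x / \<delta>\<bar> \<le> 1\<close> on the unit interval. Raising to a nonnegative
  exponent keeps this bound, and the interval has measure 1, so the modular of
  \<open>u / \<delta>\<close> is at most 1 (\<open>modular_divide_le_1\<close>, with the pointwise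
  bound from \<open>abs_le_sup_norm01\<close>). One such \<open>\<delta>\<close> gives membership in
  \<open>Lp_var p\<close>; letting \<open>\<delta>\<close> decrease to the supremum norm gives the
  inequality.\<close>

lemma modular_divide_le_1:
  fixes p u :: "real \<Rightarrow> real"
  assumes "0 < \<delta>" and bound: "\<And>x. x \<in> {0..1} \<Longrightarrow> \<bar>u x\<bar> \<le> \<delta>"
    and p: "\<And>x. x \<in> {0..1} \<Longrightarrow> 0 \<le> p x"
  shows "modular p (\<lambda>x. u x / \<delta>) \<le> 1"
proof -
  have "modular p (\<lambda>x. u x / \<delta>) \<le> (\<integral>\<^sup>+x. 1 \<partial>lebesgue_on {0..1::real})"
    unfolding modular_def
  proof (rule nn_integral_mono)
    fix x assume "x \<in> space (lebesgue_on {0..1::real})"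
    then have x: "x \<in> {0..1}" by simp
    have "\<bar>u x / \<delta>\<bar> \<le> 1"
      using bound[OF x] \<open>0 < \<delta>\<close> by simp
    then have "\<bar>u x / \<delta>\<bar> powr p x \<le> 1"
      using p[OF x] by (intro powr_le1) auto
    then show "ennreal (\<bar>u x / \<delta>\<bar> powr p x) \<le> 1"
      by simp
  qed
  also have "\<dots> = 1"
    by (simp add: emeasure_restrict_space)
  finally show ?thesis .
qed

text \<open>Compactness of the interval makes the image of \<open>\<bar>u\<bar>\<close> bounded
  above, so the real-valued \<open>SUP\<close> is a genuine upper bound.\<close>

lemma abs_le_sup_norm01:
  assumes "u \<in> C01" "x \<in> {0..1}"
  shows "\<bar>u x\<bar> \<le> sup_norm01 u"
proof -
  have "continuous_on {0..1} (\<lambda>x. \<bar>u x\<bar>)"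
    using assms(1) by (auto simp: C01_def intro: continuous_intros)
  then have "bdd_above ((\<lambda>x. \<bar>u x\<bar>) ` {0..1})"
    by (intro bounded_imp_bdd_above compact_imp_bounded compact_continuous_image) auto
  then show ?thesis
    unfolding sup_norm01_def using assms(2) by (rule cSUP_upper[rotated])
qed

theorem lemma2p6:
  fixes p :: "real \<Rightarrow> real"
  assumes "continuous_on {0..1} p"
    and "\<And>x. x \<in> {0..1} \<Longrightarrow> 1 < p x"
  shows "C01 \<subseteq> Lp_var p \<and> (\<forall>u\<in>C01. luxemburg_norm p u \<le> sup_norm01 u)"
proof -
  have p: "0 \<le> p x" if "x \<in> {0..1}" for x
    using assms(2)[OF that] by simp
  \<comment> \<open>The inequality on \<open>\<delta>\<close> is strict so that
    \<open>\<delta>\<close> is positive even for \<open>u = 0\<close> on the interval, where the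
    supremum norm vanishes.\<close>
  have modular: "0 < \<delta> \<and> modular p (\<lambda>x. u x / \<delta>) \<le> 1"
    if u: "u \<in> C01" and \<delta>: "sup_norm01 u < \<delta>" for u \<delta>
  proof -
    have le: "\<bar>u x\<bar> \<le> \<delta>" if "x \<in> {0..1}" for x
      using abs_le_sup_norm01[OF u that] \<delta> by simp
    have "0 < \<delta>"
      using abs_le_sup_norm01[OF u, of 0] \<delta> by simp
    then show ?thesis
      using modular_divide_le_1[OF _ le p] by simp
  qed
  have "u \<in> Lp_var p" if u: "u \<in> C01" for u
  proof -
    have "u \<in> borel_measurable (lebesgue_on {0..1})"
      using u by (auto simp: C01_def intro: continuous_imp_measurable_on_sets_lebesgue)
    \<comment> \<open>Adding 1 is just a convenient choice of a number above the supremum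
      norm.\<close>
    moreover have "0 < sup_norm01 u + 1 \<and> modular p (\<lambda>x. u x / (sup_norm01 u + 1)) < \<infinity>"
      using modular[OF u, of "sup_norm01 u + 1"] by (auto intro: le_less_trans)
    ultimately show ?thesis
      unfolding Lp_var_def by blast
  qed
  \<comment> \<open>By density of the reals, it suffices to bound the norm by every
    \<open>\<delta>\<close> strictly above the supremum norm.\<close>
  moreover have "luxemburg_norm p u \<le> sup_norm01 u" if u: "u \<in> C01" for u
  proof (rule dense_ge)
    fix \<delta> assume "sup_norm01 u < \<delta>"
    then show "luxemburg_norm p u \<le> \<delta>"
      unfolding luxemburg_norm_def
      \<comment> \<open>Each such \<open>\<delta>\<close> lies in the set defining the infimum,
        which is bounded below by 0.\<close>
      using modular[OF u] by (intro cInf_lower bdd_belowI[of _ 0]) auto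
  qed
  ultimately show ?thesis by blast
qed

end
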